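(* Let $s\in\mathbb{N}$ and $[1:s]=\{1,\ldots,s\}$. Let $F$ be a linear space of real-valued functions on a domain $D\subseteq\mathbb{R}^s$ and let $P_1,\ldots,P_s$ be commuting projections on $F$ as described in the context. Then a function $f\in F$ is separable with respect to all the variables if and only if \[ \left(I+(s-1)P_{[1:s]}-\sum_{j=1}^{s}P_{-\{j\}}\right)(f)=0 . \]
   Context: Notation: $\boldsymbol{x}=(x_1,\ldots,x_s)$; for $u\subseteq[1:s]$, $\boldsymbol{x}_u=(x_j)_{j\in u}$ and $-u=[1:s]\setminus u$. Setting: $F$ is a linear space of real-valued functions defined on $D\subseteq\mathbb{R}^s$. $\{P_j: j=1,\ldots,s\}$ is a set of commuting projections on $F$ such that, for every $f\in F$, $P_j(f)$ does not depend on $x_j$, and $P_j(f)=f$ whenever $f$ does not depend on $x_j$. Put $P_u=\prod_{j\in u}P_j$ for $\emptyset\ne u\subseteq[1:s]$, and $P_\emptyset=I$ (the identity operator). For every $u\subseteq[1:s]$ and $f\in F$, the function $P_u(f)$ depends only on $\boldsymbol{x}_{-u}$ (in particular $P_{[1:s]}(f)$ is a constant). Separability: $f$ is separable with respect to all the variables if there exist univariate functions $g_1,\ldots,g_s$ such that $f(\boldsymbol{x})=\sum_{j=1}^s g_j(x_j)$ holds for any $\boldsymbol{x}\in D$.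
   Formalization: Separability is taken with the additional requirement that each summand x ↦ g_j(x_j) on D belongs to F; with arbitrary univariate g_j the "only if" direction fails (e.g. F = span{1, x_1+x_2}, P_1 = P_2 sending a+b(x_1+x_2) to a). *)

theory Defs
  imports Complex_Main "HOL-Library.FuncSet"
begin

text \<open>Points of \<open>\<real>\<^sup>s\<close> are the functions in \<open>{1..s} \<rightarrow>\<^sub>E UNIV\<close>, and a real-valued function
  on \<open>D\<close> is an element of \<open>D \<rightarrow>\<^sub>E UNIV\<close>, so that equality of such functions is equality on \<open>D\<close>.\<close>

type_synonym point = "nat \<Rightarrow> real"
type_synonym func = "point \<Rightarrow> real"

definition function_space :: "point set \<Rightarrow> func set \<Rightarrow> bool" where
  "function_space D F \<longleftrightarrow>
     F \<subseteq> D \<rightarrow>\<^sub>E UNIV \<and>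
     (\<lambda>x\<in>D. 0) \<in> F \<and>
     (\<forall>f\<in>F. \<forall>g\<in>F. (\<lambda>x\<in>D. f x + g x) \<in> F) \<and>
     (\<forall>c. \<forall>f\<in>F. (\<lambda>x\<in>D. c * f x) \<in> F)"

definition depends_only_on :: "point set \<Rightarrow> func \<Rightarrow> nat set \<Rightarrow> bool" where
  "depends_only_on D f v \<longleftrightarrow> (\<forall>x\<in>D. \<forall>y\<in>D. (\<forall>i\<in>v. x i = y i) \<longrightarrow> f x = f y)"

definition projection_on :: "point set \<Rightarrow> func set \<Rightarrow> (func \<Rightarrow> func) \<Rightarrow> bool" where
  "projection_on D F Q \<longleftrightarrow>
     Q \<in> F \<rightarrow> F \<and>
     (\<forall>f\<in>F. \<forall>g\<in>F. Q (\<lambda>x\<in>D. f x + g x) = (\<lambda>x\<in>D. Q f x + Q g x)) \<and>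
     (\<forall>c. \<forall>f\<in>F. Q (\<lambda>x\<in>D. c * f x) = (\<lambda>x\<in>D. c * Q f x)) \<and>
     (\<forall>f\<in>F. Q (Q f) = Q f)"

text \<open>The operator \<open>\<Prod>j\<in>u. P j\<close>, composed in increasing order of the indices; for operators
  commuting on \<open>F\<close> the order is irrelevant on \<open>F\<close>. For \<open>u = {}\<close> it is the identity.\<close>

definition proj_prod :: "(nat \<Rightarrow> func \<Rightarrow> func) \<Rightarrow> nat set \<Rightarrow> func \<Rightarrow> func" where
  "proj_prod P u = foldr P (sorted_list_of_set u)"

text \<open>The last condition follows from the others when \<open>D\<close> is a Cartesian product, but not for an
  arbitrary \<open>D\<close>: independence of each \<open>x\<^sub>j\<close>, \<open>j \<in> u\<close>, separately does not imply joint independence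
  (on the points of \<open>{0,1}\<^sup>4\<close> with even coordinate sum, no function depends on any single \<open>x\<^sub>j\<close>
  in this sense).\<close>

definition commuting_projections ::
    "nat \<Rightarrow> point set \<Rightarrow> func set \<Rightarrow> (nat \<Rightarrow> func \<Rightarrow> func) \<Rightarrow> bool" where
  "commuting_projections s D F P \<longleftrightarrow>
     (\<forall>j\<in>{1..s}. projection_on D F (P j)) \<and>
     (\<forall>i\<in>{1..s}. \<forall>j\<in>{1..s}. \<forall>f\<in>F. P i (P j f) = P j (P i f)) \<and>
     (\<forall>j\<in>{1..s}. \<forall>f\<in>F. depends_only_on D (P j f) ({1..s} - {j})) \<and>
     (\<forall>j\<in>{1..s}. \<forall>f\<in>F. depends_only_on D f ({1..s} - {j}) \<longrightarrow> P j f = f) \<and>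
     (\<forall>u\<subseteq>{1..s}. \<forall>f\<in>F. depends_only_on D (proj_prod P u f) ({1..s} - u))"

text \<open>The summands \<open>x \<mapsto> g j (x j)\<close> are required to lie in \<open>F\<close>, as the operators act on \<open>F\<close> only.
  Without this the characterization by the projections fails: for \<open>s = 2\<close>, \<open>D = \<real>\<^sup>2\<close>,
  \<open>F = span {1, x\<^sub>1 + x\<^sub>2}\<close> and \<open>P\<^sub>1 = P\<^sub>2 : a + b(x\<^sub>1 + x\<^sub>2) \<mapsto> a\<close>, the function \<open>f = x\<^sub>1 + x\<^sub>2\<close> is a
  sum of univariate functions, but \<open>(I + P\<^sub>1P\<^sub>2 - P\<^sub>1 - P\<^sub>2) f = f \<noteq> 0\<close>.\<close>

definition separable :: "nat \<Rightarrow> point set \<Rightarrow> func set \<Rightarrow> func \<Rightarrow> bool" where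
  "separable s D F f \<longleftrightarrow>
     (\<exists>g :: nat \<Rightarrow> real \<Rightarrow> real.
        (\<forall>j\<in>{1..s}. (\<lambda>x\<in>D. g j (x j)) \<in> F) \<and>
        (\<forall>x\<in>D. f x = (\<Sum>j\<in>{1..s}. g j (x j))))"

end

theory Submission
  imports Defs
begin

text \<open>A summand \<open>h\<close> of a separable function that depends on \<open>x\<^sub>j\<close> only is fixed by \<open>P\<^bsub>-{j}\<^esub>\<close>, while
  \<open>P\<^bsub>-{k}\<^esub> h = P\<^bsub>-{k}\<^esub> (P\<^sub>k h) = P\<^bsub>[1:s]\<^esub> h\<close> for \<open>k \<noteq> j\<close>; so \<open>\<Sum>\<^sub>k P\<^bsub>-{k}\<^esub> h = h + (s - 1) P\<^bsub>[1:s]\<^esub> h\<close>,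
  and the identity follows by linearity. Conversely, the identity writes \<open>f\<close> as the sum of the
  univariate functions \<open>P\<^bsub>-{j}\<^esub> f - (s - 1)/s \<sdot> P\<^bsub>[1:s]\<^esub> f\<close>.\<close>

lemma function_space_sum:
  assumes "function_space D F" and "finite J" and "\<And>j. j \<in> J \<Longrightarrow> h j \<in> F"
  shows "(\<lambda>x\<in>D. \<Sum>j\<in>J. h j x) \<in> F"
  using assms(2,3)
proof (induction J rule: finite_induct)
  case empty
  then show ?case using assms(1) by (simp add: function_space_def del: restrict_apply)
next
  case (insert k J)
  have "(\<lambda>x\<in>D. h k x + (\<lambda>x\<in>D. \<Sum>j\<in>J. h j x) x) \<in> F"
    using assms(1) insert unfolding function_space_def by blast
  also have "(\<lambda>x\<in>D. h k x + (\<lambda>x\<in>D. \<Sum>j\<in>J. h j x) x) = (\<lambda>x\<in>D. \<Sum>j\<in>insert k J. h j x)"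
    using insert.hyps by (intro restrict_ext) simp
  finally show ?case .
qed

lemma projection_on_sum:
  assumes "function_space D F" and "projection_on D F Q"
    and "finite J" and "\<And>j. j \<in> J \<Longrightarrow> h j \<in> F"
  shows "Q (\<lambda>x\<in>D. \<Sum>j\<in>J. h j x) = (\<lambda>x\<in>D. \<Sum>j\<in>J. Q (h j) x)"
  using assms(3,4)
proof (induction J rule: finite_induct)
  case empty
  let ?z = "\<lambda>x\<in>D. 0 :: real"
  have "?z \<in> F" using assms(1) by (simp add: function_space_def)
  \<comment> \<open>Homogeneity with the scalar 0 gives that \<open>Q\<close> sends the zero
    function to itself.\<close>
  then have "Q (\<lambda>x\<in>D. 0 * ?z x) = (\<lambda>x\<in>D. 0 * Q ?z x)"
    using assms(2) unfolding projection_on_def by blast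
  then show ?case by (simp del: restrict_apply)
next
  case (insert k J)
  let ?r = "\<lambda>x\<in>D. \<Sum>j\<in>J. h j x"
  have "?r \<in> F" using insert by (intro function_space_sum[OF assms(1)]) auto
  then have "Q (\<lambda>x\<in>D. h k x + ?r x) = (\<lambda>x\<in>D. Q (h k) x + Q ?r x)"
    using assms(2) insert.prems unfolding projection_on_def by blast
  also have "(\<lambda>x\<in>D. h k x + ?r x) = (\<lambda>x\<in>D. \<Sum>j\<in>insert k J. h j x)"
    using insert.hyps by (intro restrict_ext) simp
  also have "Q ?r = (\<lambda>x\<in>D. \<Sum>j\<in>J. Q (h j) x)"
    using insert by blast
  also have "(\<lambda>x\<in>D. Q (h k) x + (\<lambda>x\<in>D. \<Sum>j\<in>J. Q (h j) x) x) = (\<lambda>x\<in>D. \<Sum>j\<in>insert k J. Q (h j) x)"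
    using insert.hyps by (intro restrict_ext) simp
  finally show ?case .
qed

lemma foldr_closed:
  assumes "\<And>j. j \<in> set xs \<Longrightarrow> P j \<in> F \<rightarrow> F" and "f \<in> F"
  shows "foldr P xs f \<in> F"
  using assms by (induction xs) fastforce+

text \<open>Linearity of every \<open>proj_prod P u\<close>: each further projection passes through
  the sum because the inner composites stay in \<open>F\<close>.\<close>

lemma foldr_projection_sum:
  assumes "function_space D F" and "\<And>j. j \<in> set xs \<Longrightarrow> projection_on D F (P j)"
    and "finite J" and "\<And>j. j \<in> J \<Longrightarrow> h j \<in> F"
  shows "foldr P xs (\<lambda>x\<in>D. \<Sum>j\<in>J. h j x) = (\<lambda>x\<in>D. \<Sum>j\<in>J. foldr P xs (h j) x)"
  using assms(2)
proof (induction xs)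
  case (Cons k xs)
  have "foldr P xs (h j) \<in> F" if "j \<in> J" for j
    using Cons.prems assms(4)[OF that] by (intro foldr_closed) (auto simp: projection_on_def)
  then have "P k (\<lambda>x\<in>D. \<Sum>j\<in>J. foldr P xs (h j) x) = (\<lambda>x\<in>D. \<Sum>j\<in>J. P k (foldr P xs (h j)) x)"
    using Cons.prems assms(3) by (intro projection_on_sum[OF assms(1)]) auto
  then show ?case
    using Cons by (simp del: restrict_apply)
qed simp

text \<open>\<open>P k\<close> commutes past the entries that follow its sorted position, which are
  applied before it, and so becomes the innermost factor. Commutation is given on \<open>F\<close>
  only, hence the need for closedness.\<close>

lemma foldr_insort:
  assumes "\<And>j. j \<in> set xs \<Longrightarrow> P j \<in> F \<rightarrow> F" and "f \<in> F"
    and "\<And>j g. \<lbrakk>j \<in> set xs; g \<in> F\<rbrakk> \<Longrightarrow> P k (P j g) = P j (P k g)"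
  shows "foldr P (insort k xs) f = foldr P xs (P k f)"
proof -
  have comm: "P k (foldr P ys f) = foldr P ys (P k f)" if "set ys \<subseteq> set xs" for ys
    using that
  proof (induction ys)
    case (Cons y ys)
    then have "foldr P ys f \<in> F" using assms(1,2) by (intro foldr_closed) auto
    then show ?case using Cons assms(3) by simp
  qed simp
  have "foldr P (insort k ys) f = foldr P ys (P k f)" if "set ys \<subseteq> set xs" for ys
    using that
  proof (induction ys)
    case (Cons y ys)
    then show ?case using comm[of "y # ys"] by simp
  qed simp
  then show ?thesis by blast
qed

text \<open>Makes \<open>P k\<close> the first operator applied, so that a function fixed by
  \<open>P k\<close> has the same image under the full product and under the product without
  \<open>k\<close>.\<close>

lemma proj_prod_remove:
  assumes "commuting_projections s D F P" and "k \<in> {1..s}" and "f \<in> F"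
  shows "proj_prod P {1..s} f = proj_prod P ({1..s} - {k}) (P k f)"
proof -
  have "sorted_list_of_set {1..s} = insort k (sorted_list_of_set ({1..s} - {k}))"
    using sorted_list_of_set.fold_insort_key.remove[of "{1..s}" k] assms(2) by simp
  moreover have "foldr P (insort k (sorted_list_of_set ({1..s} - {k}))) f =
      foldr P (sorted_list_of_set ({1..s} - {k})) (P k f)"
    by (rule foldr_insort[where F = F])
      (use assms in \<open>auto simp: commuting_projections_def projection_on_def\<close>)
  ultimately show ?thesis by (simp only: proj_prod_def)
qed

lemma proj_prod_fixed:
  assumes "finite u" and "\<And>j. j \<in> u \<Longrightarrow> P j f = f"
  shows "proj_prod P u f = f"
proof -
  have "foldr P xs f = f" if "set xs \<subseteq> u" for xs
    using that assms(2) by (induction xs) auto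
  then show ?thesis using assms(1) by (simp add: proj_prod_def)
qed

lemma depends_only_on_mono:
  "\<lbrakk>depends_only_on D f v; v \<subseteq> w\<rbrakk> \<Longrightarrow> depends_only_on D f w"
  unfolding depends_only_on_def by blast

text \<open>For arbitrary \<open>D\<close> the other coordinates cannot simply be frozen, so
  \<open>g t\<close> is the value of \<open>q\<close> at some chosen point of \<open>D\<close> with
  \<open>j\<close>-th coordinate \<open>t\<close>; the choice does not affect the value. Where no
  such point exists, \<open>g t\<close> is irrelevant.\<close>

lemma depends_only_on_singleton:
  assumes "depends_only_on D q {j}"
  obtains g where "\<And>x. x \<in> D \<Longrightarrow> g (x j) = q x"
proof
  fix x assume x: "x \<in> D"
  let ?y = "SOME y. y \<in> D \<and> y j = x j"
  have "?y \<in> D \<and> ?y j = x j"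
    by (rule someI[where x = x]) (use x in simp)
  then show "(\<lambda>t. q (SOME y. y \<in> D \<and> y j = t)) (x j) = q x"
    using assms x unfolding depends_only_on_def by blast
qed

lemma sum_proj_prod_univariate:
  assumes cp: "commuting_projections s D F P" and h: "h \<in> F"
    and dep: "depends_only_on D h {j}" and j: "j \<in> {1..s}"
  shows "(\<Sum>k\<in>{1..s}. proj_prod P ({1..s} - {k}) h x) = h x + (real s - 1) * proj_prod P {1..s} h x"
proof -
  have fixed: "P k h = h" if "k \<in> {1..s} - {j}" for k
  proof -
    have "depends_only_on D h ({1..s} - {k})"
      using depends_only_on_mono[OF dep] that j by auto
    then show ?thesis using cp h that by (auto simp: commuting_projections_def)
  qed
  have "proj_prod P ({1..s} - {j}) h = h"
    using fixed by (intro proj_prod_fixed) auto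
  moreover have "proj_prod P ({1..s} - {k}) h = proj_prod P {1..s} h" if "k \<in> {1..s} - {j}" for k
    using proj_prod_remove[OF cp _ h, of k] fixed[OF that] that by simp
  \<comment> \<open>The membership of \<open>j\<close> in \<open>{1..s}\<close> forces 1 \<le>
    \<open>s\<close>, so the truncated difference is the real one.\<close>
  moreover have "real (card ({1..s} - {j})) = real s - 1"
    using j by (simp add: of_nat_diff)
  ultimately show ?thesis
    using j by (subst sum.remove[of _ j]) simp_all
qed

theorem corollary2:
  fixes s :: nat and D :: "point set" and F :: "func set"
    and P :: "nat \<Rightarrow> func \<Rightarrow> func" and f :: func
  assumes "s \<ge> 1"
    and "D \<subseteq> {1..s} \<rightarrow>\<^sub>E UNIV"
    and "function_space D F"
    and "commuting_projections s D F P"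
    and "f \<in> F"
  shows "separable s D F f \<longleftrightarrow>
    (\<lambda>x\<in>D. f x + (real s - 1) * proj_prod P {1..s} f x
            - (\<Sum>j\<in>{1..s}. proj_prod P ({1..s} - {j}) f x)) = (\<lambda>x\<in>D. 0)"
    (is "_ \<longleftrightarrow> ?rhs")
proof
  have proj: "projection_on D F (P j)" if "j \<in> {1..s}" for j
    using assms(4) that by (simp add: commuting_projections_def)
  show ?rhs if sep: "separable s D F f"
  proof -
    obtain g where g: "\<And>j. j \<in> {1..s} \<Longrightarrow> (\<lambda>x\<in>D. g j (x j)) \<in> F"
      and sum: "\<And>x. x \<in> D \<Longrightarrow> f x = (\<Sum>j\<in>{1..s}. g j (x j))"
      using sep unfolding separable_def by blast
    define h where "h j = (\<lambda>x\<in>D. g j (x j))" for j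
    have h: "h j \<in> F" if "j \<in> {1..s}" for j using g[OF that] by (simp add: h_def)
    \<comment> \<open>Both sides are \<open>undefined\<close> off \<open>D\<close>, so the pointwise
      sum on \<open>D\<close> becomes an equation of functions to which the operators apply.\<close>
    have "f \<in> D \<rightarrow>\<^sub>E UNIV" using assms(3,5) unfolding function_space_def by blast
    then have f: "f = (\<lambda>x\<in>D. \<Sum>j\<in>{1..s}. h j x)"
      by (intro extensionalityI[of _ D]) (auto simp: sum h_def PiE_def)
    have lin: "proj_prod P u f = (\<lambda>x\<in>D. \<Sum>j\<in>{1..s}. proj_prod P u (h j) x)"
      if "u \<subseteq> {1..s}" for u
    proof -
      have "finite u" using that finite_subset by blast
      then show ?thesis unfolding proj_prod_def f
        by (intro foldr_projection_sum[OF assms(3)]) (use that proj h in auto)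
    qed
    have "f x + (real s - 1) * proj_prod P {1..s} f x
        = (\<Sum>k\<in>{1..s}. proj_prod P ({1..s} - {k}) f x)" if x: "x \<in> D" for x
    proof -
      have dep: "depends_only_on D (h j) {j}" for j
        by (simp add: depends_only_on_def h_def)
      have "(\<Sum>k\<in>{1..s}. proj_prod P ({1..s} - {k}) f x)
          = (\<Sum>k\<in>{1..s}. \<Sum>j\<in>{1..s}. proj_prod P ({1..s} - {k}) (h j) x)"
        using x by (simp add: lin)
      \<comment> \<open>After the swap the inner sum concerns a single univariate summand
        \<open>h j\<close>.\<close>
      also have "\<dots> = (\<Sum>j\<in>{1..s}. \<Sum>k\<in>{1..s}. proj_prod P ({1..s} - {k}) (h j) x)"
        by (rule sum.swap)
      also have "\<dots> = (\<Sum>j\<in>{1..s}. h j x + (real s - 1) * proj_prod P {1..s} (h j) x)"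
        using sum_proj_prod_univariate[OF assms(4) h dep] by (intro sum.cong) auto
      also have "\<dots> = f x + (real s - 1) * proj_prod P {1..s} f x"
        using x lin[of "{1..s}"] fun_cong[OF f, of x] by (simp add: sum.distrib sum_distrib_left)
      finally show ?thesis by simp
    qed
    then show ?thesis by (intro restrict_ext) simp
  qed
  show "separable s D F f" if eq: ?rhs
  proof -
    have maps: "P j \<in> F \<rightarrow> F" if "j \<in> {1..s}" for j
      using proj[OF that] by (simp add: projection_on_def)
    have closed: "proj_prod P u f \<in> F" if "u \<subseteq> {1..s}" for u
    proof -
      have "finite u" using that finite_subset by blast
      then show ?thesis unfolding proj_prod_def
        by (intro foldr_closed) (use that maps assms(5) \<open>finite u\<close> in fastforce)+
    qed
    have dep: "depends_only_on D (proj_prod P u f) ({1..s} - u)" if "u \<subseteq> {1..s}" for u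
      using assms(4,5) that unfolding commuting_projections_def by blast
    \<comment> \<open>By \<open>eq\<close> the projections onto single variables add up to
      \<open>f\<close> plus \<open>s - 1\<close> copies of the constant part; this surplus is
      removed in \<open>s\<close> equal shares.\<close>
    define c where "c = - ((real s - 1) / real s)"
    define q where "q j = (\<lambda>x\<in>D. proj_prod P ({1..s} - {j}) f x + c * proj_prod P {1..s} f x)" for j
    have qF: "q j \<in> F" for j
    proof -
      have "(\<lambda>x\<in>D. c * proj_prod P {1..s} f x) \<in> F"
        using assms(3) closed[of "{1..s}"] unfolding function_space_def by blast
      \<comment> \<open>The inner restriction gives the second summand the literal form of an
        element of \<open>F\<close>.\<close>
      then have "(\<lambda>x\<in>D. proj_prod P ({1..s} - {j}) f x
          + (\<lambda>x\<in>D. c * proj_prod P {1..s} f x) x) \<in> F"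
        using assms(3) closed[of "{1..s} - {j}"] unfolding function_space_def by blast
      then show ?thesis by (simp add: q_def cong: restrict_cong)
    qed
    have "\<exists>g. \<forall>x\<in>D. g (x j) = q j x" if j: "j \<in> {1..s}" for j
    proof -
      have "{1..s} - ({1..s} - {j}) = {j}" using j by auto
      then have dep1: "depends_only_on D (proj_prod P ({1..s} - {j}) f) {j}"
        using dep[of "{1..s} - {j}"] by simp
      \<comment> \<open>The full product depends on the empty set of coordinates, so it is constant
        on \<open>D\<close> and fits into any univariate summand.\<close>
      have dep2: "depends_only_on D (proj_prod P {1..s} f) {j}"
        by (rule depends_only_on_mono[OF dep]) auto
      have "depends_only_on D (q j) {j}"
        using dep1 dep2 unfolding depends_only_on_def q_def restrict_def by metis
      then show ?thesis by (rule depends_only_on_singleton) blast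
    qed
    then have "\<forall>j\<in>{1..s}. \<exists>g. \<forall>x\<in>D. g (x j) = q j x" by blast
    then obtain g where "\<forall>j\<in>{1..s}. \<forall>x\<in>D. g j (x j) = q j x"
      by (rule bchoice[THEN exE])
    then have g: "\<And>j x. \<lbrakk>j \<in> {1..s}; x \<in> D\<rbrakk> \<Longrightarrow> g j (x j) = q j x" by blast
    have "(\<lambda>x\<in>D. g j (x j)) \<in> F" if "j \<in> {1..s}" for j
    proof -
      have "(\<lambda>x\<in>D. g j (x j)) = q j"
        using g[OF that] by (auto simp: q_def fun_eq_iff)
      then show ?thesis using qF by simp
    qed
    moreover have "f x = (\<Sum>j\<in>{1..s}. g j (x j))" if x: "x \<in> D" for x
    proof -
      have "(\<Sum>j\<in>{1..s}. g j (x j)) = (\<Sum>j\<in>{1..s}. q j x)"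
        using g x by simp
      \<comment> \<open>Here \<open>s\<close> \<ge> 1 permits cancelling \<open>s\<close> in
        \<open>s * c\<close>, which leaves \<open>- (s - 1)\<close>.\<close>
      also have "\<dots> = (\<Sum>j\<in>{1..s}. proj_prod P ({1..s} - {j}) f x)
          - (real s - 1) * proj_prod P {1..s} f x"
        using x assms(1) by (simp add: q_def c_def sum_subtractf)
      also have "\<dots> = f x"
        using fun_cong[OF eq, of x] x by (simp only: restrict_apply' algebra_simps)
      finally show ?thesis by simp
    qed
    ultimately show ?thesis unfolding separable_def by blast
  qed
qed

end
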